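(* Consider the robust remanufacturing planning model with interval-matrix ambiguity sets $\mathcal{U}_{sk}=\{\pmb p(\cdot|s,k):\underline p(s'|s,k)\le p(s'|s,k)\le\bar p(s'|s,k)\ \forall s'\in\mathcal{S},\ \sum_{s'\in\mathcal{S}}p(s'|s,k)=1\}$, where $\underline p,\bar p$ denote effective bounds, under the standing assumption (R) given in the context. Suppose that for all $i\in\mathcal{S}$: $$\sum_{s''=0}^{i}\underline p(s''|s,k)\ge\sum_{s''=0}^{i}\underline p(s''|s',k)\quad\text{and}\quad \sum_{s''=i}^{S}\bar p(s''|s,k)\le\sum_{s''=i}^{S}\bar p(s''|s',k)\qquad\text{for all }k\in\mathcal{K},\ s'\ge s,$$ $$\sum_{s''=0}^{i}\underline p(s''|s,k)\ge\sum_{s''=0}^{i}\underline p(s''|s,k')\quad\text{and}\quad \sum_{s''=i}^{S}\bar p(s''|s,k)\le\sum_{s''=i}^{S}\bar p(s''|s,k')\qquad\text{for all }s\in\mathcal{S},\ k'\ge k.$$ Then there exist a cumulative number of remanufacturings $k^\ast\in\mathcal{K}$ and, for each $k\in\mathcal{K}$, an operational state $s_k\in\mathcal{S}$ such that the optimal robust policy $a(s,k)$ satisfies: for $k<k^\ast$, $$a(s,k)=\begin{cases}0 & \text{if } s<s_k,\\ 1 & \text{if } s\ge s_k,\end{cases}$$ and for $k\ge k^\ast$, $$a(s,k)=\begin{cases}0 & \text{if } s<s_k,\\ 2 & \text{if } s\ge s_k.\end{cases}$$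
   Context: Model. $\mathcal{S}=\{0,1,\dots,S\}$ is the set of conditions of a component (larger is worse), $\mathcal{K}=\{0,1,2,\dots\}$ is the set of cumulative numbers of completed remanufacturing activities, and $\mathcal{A}=\{0,1,2\}$ is the set of actions ($0$: continue operation, $1$: remanufacture, $2$: scrap). The one-period reward of operating is $r(s,k)=g(s,k)-e(s,k)$, where $g$ is the operational gain and $e$ the environmental (carbon) cost; $c_{\rm r}$ is the remanufacturing cost, $c_{\rm s}$ the salvage value, $\beta\in(0,1)$ the discount factor. Under action $0$ the component at $(s,k)$ moves to $(s',k)$ with probability $p(s'|s,k)$; deterioration is irreversible ($p(s'|s,k)=0$ for $s'<s$), and $S$ is absorbing under action $0$. The row $\pmb p(\cdot|s,k)$ is only known to lie in an ambiguity set $\mathcal{U}_{sk}$, and the overall ambiguity set is the product $\bigotimes_{s,k}\mathcal{U}_{sk}$ (rectangularity). The value function $V$ satisfies $$V(s,k)=\max_{a\in\mathcal{A}}w(s,k;a),$$ $$w(s,k;0)=\inf_{\pmb p(\cdot|s,k)\in\mathcal{U}_{sk}}\Big\{r(s,k)+\beta\sum_{s'\in\mathcal{S}}p(s'|s,k)V(s',k)\Big\},\quad w(s,k;1)=-c_{\rm r}+\beta V(0,k+1),\quad w(s,k;2)=c_{\rm s},$$ and is the limit of robust value iteration (iterating the right-hand side starting from the zero function). The optimal robust policy is $a(s,k)\in\arg\max_{a\in\mathcal{A}}w(s,k;a)$. Interval matrix model. Given bounds $0\le\underline p\le\bar p\le1$ with $\mathcal{U}_{sk}$ nonempty and every row in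 $\mathcal{U}_{sk}$ respecting irreversibility and absorption at $S$, the effective upper bounds are $\min\{\bar p(s'|s,k),\,1-\sum_{s''\ne s'}\underline p(s''|s,k)\}$ and the effective lower bounds are $\max\{\underline p(s'|s,k),\,1-\sum_{s''\ne s'}\bar p(s''|s,k)\}$. Throughout, $\bar p$ and $\underline p$ denote these effective bounds. Standing assumption. (R) $g(s,k)$ is non-increasing in $s$ and in $k$; $e(s,k)$ is non-decreasing in $s$ and in $k$; and $\frac{r(S,0)}{1-\beta}<c_{\rm s}$.
   Formalization: k* may be infinite (remanufacturing can beat scrapping for every k, so a finite k* need not exist), and the optimal robust policy is any selection from the argmax that breaks ties by one fixed, arbitrary strict order on the actions. *)

theory Defs
  imports Complex_Main "HOL-Library.Extended_Nat"
begin

text \<open>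
  Conditions \<open>s\<close> and remanufacturing counts \<open>k\<close> are natural numbers; the state space is
  \<open>{..max_state M}\<close>, and everything below is only meaningful for \<open>s \<le> max_state M\<close>.
  Arguments of bounds are ordered as origin, count, destination: \<open>lower_bound M s k s'\<close> bounds
  the probability \<open>p(s'|s,k)\<close> of moving from \<open>(s, k)\<close> to \<open>(s', k)\<close> while operating.
  Actions are 0 (continue), 1 (remanufacture) and 2 (scrap).
\<close>

record remanufacturing_model =
  max_state :: nat
  gain :: "nat \<Rightarrow> nat \<Rightarrow> real"
  carbon_cost :: "nat \<Rightarrow> nat \<Rightarrow> real"
  reman_cost :: real
  salvage_value :: real
  discount :: real
  lower_bound :: "nat \<Rightarrow> nat \<Rightarrow> nat \<Rightarrow> real"
  upper_bound :: "nat \<Rightarrow> nat \<Rightarrow> nat \<Rightarrow> real"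

abbreviation states :: "remanufacturing_model \<Rightarrow> nat set" where
  "states M \<equiv> {..max_state M}"

definition reward :: "remanufacturing_model \<Rightarrow> nat \<Rightarrow> nat \<Rightarrow> real" where
  "reward M s k = gain M s k - carbon_cost M s k"

definition eff_upper :: "remanufacturing_model \<Rightarrow> nat \<Rightarrow> nat \<Rightarrow> nat \<Rightarrow> real" where
  "eff_upper M s k s' =
     min (upper_bound M s k s') (1 - (\<Sum>s''\<in>states M - {s'}. lower_bound M s k s''))"

definition eff_lower :: "remanufacturing_model \<Rightarrow> nat \<Rightarrow> nat \<Rightarrow> nat \<Rightarrow> real" where
  "eff_lower M s k s' =
     max (lower_bound M s k s') (1 - (\<Sum>s''\<in>states M - {s'}. upper_bound M s k s''))"

text \<open>The values of a row outside the state space are unconstrained and never used.\<close>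

definition ambiguity_set :: "remanufacturing_model \<Rightarrow> nat \<Rightarrow> nat \<Rightarrow> (nat \<Rightarrow> real) set" where
  "ambiguity_set M s k =
     {p. (\<forall>s'\<in>states M. eff_lower M s k s' \<le> p s' \<and> p s' \<le> eff_upper M s k s') \<and>
         (\<Sum>s'\<in>states M. p s') = 1}"

definition interval_model :: "remanufacturing_model \<Rightarrow> bool" where
  "interval_model M \<longleftrightarrow>
     0 < discount M \<and> discount M < 1 \<and>
     (\<forall>k. \<forall>s\<in>states M.
        (\<forall>s'\<in>states M. 0 \<le> lower_bound M s k s' \<and>
           lower_bound M s k s' \<le> upper_bound M s k s' \<and> upper_bound M s k s' \<le> 1) \<and>
        ambiguity_set M s k \<noteq> {} \<and>
        (\<forall>p\<in>ambiguity_set M s k. \<forall>s'<s. p s' = 0)) \<and>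
     (\<forall>k. \<forall>p\<in>ambiguity_set M (max_state M) k. p (max_state M) = 1)"

definition assumption_R :: "remanufacturing_model \<Rightarrow> bool" where
  "assumption_R M \<longleftrightarrow>
     (\<forall>k. \<forall>s\<in>states M. \<forall>s'\<in>states M. s \<le> s' \<longrightarrow>
        gain M s' k \<le> gain M s k \<and> carbon_cost M s k \<le> carbon_cost M s' k) \<and>
     (\<forall>s\<in>states M. \<forall>k k'. k \<le> k' \<longrightarrow>
        gain M s k' \<le> gain M s k \<and> carbon_cost M s k \<le> carbon_cost M s k') \<and>
     reward M (max_state M) 0 / (1 - discount M) < salvage_value M"

definition actions :: "nat set" where
  "actions = {0, 1, 2}"

definition action_value ::
  "remanufacturing_model \<Rightarrow> (nat \<Rightarrow> nat \<Rightarrow> real) \<Rightarrow> nat \<Rightarrow> nat \<Rightarrow> nat \<Rightarrow> real" where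
  "action_value M V s k a =
     (if a = 0 then
        (INF p\<in>ambiguity_set M s k.
           reward M s k + discount M * (\<Sum>s'\<in>states M. p s' * V s' k))
      else if a = 1 then - reman_cost M + discount M * V 0 (k + 1)
      else salvage_value M)"

primrec value_iterate :: "remanufacturing_model \<Rightarrow> nat \<Rightarrow> nat \<Rightarrow> nat \<Rightarrow> real" where
  "value_iterate M 0 = (\<lambda>s k. 0)"
| "value_iterate M (Suc n) =
     (\<lambda>s k. Max (action_value M (value_iterate M n) s k ` actions))"

definition robust_value :: "remanufacturing_model \<Rightarrow> nat \<Rightarrow> nat \<Rightarrow> real" where
  "robust_value M s k = lim (\<lambda>n. value_iterate M n s k)"

definition optimal_action :: "remanufacturing_model \<Rightarrow> nat \<Rightarrow> nat \<Rightarrow> nat \<Rightarrow> bool" where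
  "optimal_action M s k =
     is_arg_max (action_value M (robust_value M) s k) (\<lambda>a. a \<in> actions)"

text \<open>
  The maximiser need not be unique, and a policy that resolves ties differently at different
  \<open>(s, k)\<close> need not have any threshold structure. ``The'' optimal policy is therefore the one
  that always resolves ties by the same strict preference order on actions (smaller \<open>pref\<close>
  first); the order itself is arbitrary, and irrelevant where the maximiser is unique.
\<close>

definition optimal_policy ::
  "remanufacturing_model \<Rightarrow> (nat \<Rightarrow> nat) \<Rightarrow> (nat \<Rightarrow> nat \<Rightarrow> nat) \<Rightarrow> bool" where
  "optimal_policy M pref a \<longleftrightarrow>
     inj_on pref actions \<and>
     (\<forall>k. \<forall>s\<in>states M. is_arg_min pref (optimal_action M s k) (a s k))"

end

theory Submission
  imports Defs
begin

text \<open>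
  For a non-increasing value vector the worst row of an interval set pushes as much mass as
  possible towards bad conditions; its cumulative masses are
  \<open>max (\<Sum>j<i. l j) (1 - (\<Sum>j=i..S. u j))\<close>. The hypotheses on the partial sums of the bounds say
  exactly that these are smaller at a worse \<open>(s, k)\<close>, so first-order stochastic dominance makes
  every value iterate, hence the value function, non-increasing in \<open>s\<close> and \<open>k\<close>. The value of
  operating is thus non-increasing in \<open>s\<close>, while the other two values do not depend on \<open>s\<close>, and the
  value of remanufacturing is non-increasing in \<open>k\<close>, while that of scrapping is constant. Operating
  at \<open>S\<close> forever is worth at most \<open>r(S, 0) / (1 - \<beta>) < c\<^sub>s\<close>, so it is never optimal there.
\<close>

section \<open>Stochastic dominance and worst rows\<close>

text \<open>Abel summation: a nonpositive partial sum times \<open>v i\<close> can only grow when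
  \<open>v i\<close> drops to \<open>v (Suc i)\<close>.\<close>

lemma sum_mult_antimono_le:
  fixes d v :: "nat \<Rightarrow> real"
  assumes "\<And>i. i < n \<Longrightarrow> (\<Sum>j\<le>i. d j) \<le> 0"
    and "\<And>i. i < n \<Longrightarrow> v (Suc i) \<le> v i"
  shows "(\<Sum>j\<le>n. d j * v j) \<le> (\<Sum>j\<le>n. d j) * v n"
  using assms
proof (induction n)
  case 0
  then show ?case by simp
next
  case (Suc n)
  have "(\<Sum>j\<le>n. d j) * v n \<le> (\<Sum>j\<le>n. d j) * v (Suc n)"
    using Suc.prems by (intro mult_left_mono_neg) auto
  moreover have "(\<Sum>j\<le>n. d j * v j) \<le> (\<Sum>j\<le>n. d j) * v n"
    using Suc by auto
  ultimately show ?case by (simp add: algebra_simps)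
qed

lemma stochastic_dominance_sum_le:
  fixes p q v :: "nat \<Rightarrow> real"
  assumes "\<And>i. i \<le> n \<Longrightarrow> (\<Sum>j\<le>i. q j) \<le> (\<Sum>j\<le>i. p j)"
    and "(\<Sum>j\<le>n. q j) = (\<Sum>j\<le>n. p j)"
    and "\<And>i. i < n \<Longrightarrow> v (Suc i) \<le> v i"
  shows "(\<Sum>j\<le>n. q j * v j) \<le> (\<Sum>j\<le>n. p j * v j)"
proof -
  \<comment> \<open>\<open>q - p\<close> has total mass zero, so the right-hand side
    vanishes.\<close>
  have "(\<Sum>j\<le>n. (q j - p j) * v j) \<le> (\<Sum>j\<le>n. q j - p j) * v n"
    using assms by (intro sum_mult_antimono_le) (auto simp: sum_subtractf)
  then show ?thesis
    using assms(2) by (simp add: sum_subtractf left_diff_distrib)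
qed

text \<open>The witness is the worst row of the primed set, whatever \<open>p\<close> is;
  \<open>p'\<close> certifies that this set is nonempty.\<close>

lemma interval_row_dominated:
  fixes l u l' u' p p' :: "nat \<Rightarrow> real"
  assumes p: "\<And>j. j \<le> n \<Longrightarrow> l j \<le> p j \<and> p j \<le> u j" "(\<Sum>j\<le>n. p j) = 1"
    and p': "\<And>j. j \<le> n \<Longrightarrow> l' j \<le> p' j \<and> p' j \<le> u' j" "(\<Sum>j\<le>n. p' j) = 1"
    and l: "\<And>i. i \<le> n \<Longrightarrow> (\<Sum>j=0..i. l' j) \<le> (\<Sum>j=0..i. l j)"
    and u: "\<And>i. i \<le> n \<Longrightarrow> (\<Sum>j=i..n. u j) \<le> (\<Sum>j=i..n. u' j)"
  obtains q where "\<And>j. j \<le> n \<Longrightarrow> l' j \<le> q j \<and> q j \<le> u' j" "(\<Sum>j\<le>n. q j) = 1"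
    "\<And>i. i \<le> n \<Longrightarrow> (\<Sum>j\<le>i. q j) \<le> (\<Sum>j\<le>i. p j)"
proof
  \<comment> \<open>\<open>H i\<close> is the mass of \<open>q\<close> below \<open>i\<close>: the
    larger of what the lower bounds force there and what the upper bounds from \<open>i\<close> on
    leave over. At \<open>Suc n\<close> that tail is empty.\<close>
  define H where "H i = max (\<Sum>j<i. l' j) (1 - (\<Sum>j=i..n. u' j))" for i
  define q where "q i = H (Suc i) - H i" for i
  have H0: "H 0 = 0"
  proof -
    have "(\<Sum>j\<le>n. p' j) \<le> (\<Sum>j=0..n. u' j)"
      unfolding atMost_atLeast0 using p' by (intro sum_mono) auto
    then show ?thesis using p'(2) by (simp add: H_def)
  qed
  have Hn: "H (Suc n) = 1"
  proof -
    have "(\<Sum>j\<le>n. l' j) \<le> (\<Sum>j\<le>n. p' j)"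
      using p' by (intro sum_mono) auto
    then show ?thesis using p'(2) by (simp add: H_def lessThan_Suc_atMost)
  qed
  have sum_q: "(\<Sum>j\<le>i. q j) = H (Suc i)" for i
    using sum_lessThan_telescope[of H "Suc i"] H0
    by (simp add: q_def lessThan_Suc_atMost)
  show "(\<Sum>j\<le>n. q j) = 1"
    by (simp add: sum_q Hn)
  \<comment> \<open>Passing to \<open>Suc j\<close> adds \<open>l' j\<close> to the first argument
    of the maximum and \<open>u' j\<close> to the second, so the maximum grows by an amount in
    between.\<close>
  show "l' j \<le> q j \<and> q j \<le> u' j" if "j \<le> n" for j
  proof -
    have "(\<Sum>i=j..n. u' i) = u' j + (\<Sum>i=Suc j..n. u' i)"
      using that by (rule sum.atLeast_Suc_atMost)
    then show ?thesis
      using p'(1)[OF that] by (simp add: q_def H_def max_def)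
  qed
  show "(\<Sum>j\<le>i. q j) \<le> (\<Sum>j\<le>i. p j)" if i: "i \<le> n" for i
  \<comment> \<open>At \<open>n\<close> both sums are \<open>1\<close>; below \<open>n\<close>, the
    tail from \<open>Suc i\<close> is nonempty, as the hypothesis on upper bounds requires.\<close>
  proof (cases "i = n")
    case True
    then show ?thesis by (simp add: sum_q Hn p)
  next
    case False
    then have "Suc i \<le> n" using i by simp
    have "(\<Sum>j<Suc i. l' j) \<le> (\<Sum>j\<le>i. l j)"
      using l[OF i] by (simp add: atMost_atLeast0 lessThan_Suc_atMost)
    also have "\<dots> \<le> (\<Sum>j\<le>i. p j)"
      using p i by (intro sum_mono) auto
    finally have 1: "(\<Sum>j<Suc i. l' j) \<le> (\<Sum>j\<le>i. p j)" .
    have "(\<Sum>j=Suc i..n. p j) \<le> (\<Sum>j=Suc i..n. u j)"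
      using p by (intro sum_mono) auto
    also have "\<dots> \<le> (\<Sum>j=Suc i..n. u' j)"
      using u \<open>Suc i \<le> n\<close> by blast
    finally have "(\<Sum>j=Suc i..n. p j) \<le> (\<Sum>j=Suc i..n. u' j)" .
    moreover have "(\<Sum>j\<le>n. p j) = (\<Sum>j\<le>i. p j) + (\<Sum>j=Suc i..n. p j)"
      using i sum_up_index_split[of p i "n - i"] by simp
    ultimately show ?thesis
      using 1 p(2) by (simp add: sum_q H_def)
  qed
qed

section \<open>The interval model\<close>

lemma Max_action_value:
  "Max (action_value M V s k ` actions) =
     max (action_value M V s k 0) (max (action_value M V s k 1) (action_value M V s k 2))"
  by (simp add: actions_def max.assoc)

locale monotone_interval_model =
  fixes M :: remanufacturing_model
  assumes interval: "interval_model M"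
    and R: "assumption_R M"
    and mono_state: "\<And>i k s s'. i \<in> states M \<Longrightarrow> s \<in> states M \<Longrightarrow> s' \<in> states M \<Longrightarrow> s \<le> s' \<Longrightarrow>
           (\<Sum>s''=0..i. eff_lower M s k s'') \<ge> (\<Sum>s''=0..i. eff_lower M s' k s'') \<and>
           (\<Sum>s''=i..max_state M. eff_upper M s k s'') \<le> (\<Sum>s''=i..max_state M. eff_upper M s' k s'')"
    and mono_count: "\<And>i s k k'. i \<in> states M \<Longrightarrow> s \<in> states M \<Longrightarrow> k \<le> k' \<Longrightarrow>
           (\<Sum>s''=0..i. eff_lower M s k s'') \<ge> (\<Sum>s''=0..i. eff_lower M s k' s'') \<and>
           (\<Sum>s''=i..max_state M. eff_upper M s k s'') \<le> (\<Sum>s''=i..max_state M. eff_upper M s k' s'')"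
begin

lemma discount_pos: "0 < discount M" and discount_less_1: "discount M < 1"
  using interval by (auto simp: interval_model_def)

lemma ambiguity_set_nonempty: "s \<in> states M \<Longrightarrow> ambiguity_set M s k \<noteq> {}"
  using interval by (auto simp: interval_model_def)

lemma ambiguity_set_nonneg:
  assumes "s \<in> states M" "p \<in> ambiguity_set M s k" "j \<in> states M"
  shows "0 \<le> p j"
proof -
  have "0 \<le> lower_bound M s k j"
    using interval assms by (auto simp: interval_model_def)
  also have "\<dots> \<le> eff_lower M s k j"
    by (simp add: eff_lower_def)
  also have "\<dots> \<le> p j"
    using assms by (simp add: ambiguity_set_def)
  finally show ?thesis .
qed

lemma ambiguity_set_sum: "p \<in> ambiguity_set M s k \<Longrightarrow> (\<Sum>j\<in>states M. p j) = 1"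
  by (simp add: ambiguity_set_def)

lemma ambiguity_set_max_state:
  assumes "p \<in> ambiguity_set M (max_state M) k"
  shows "(\<Sum>j\<in>states M. p j * v j) = v (max_state M)"
proof -
  have "p j = 0" if "j < max_state M" for j
    using interval assms that by (auto simp: interval_model_def)
  then have "(\<Sum>j\<in>states M. p j * v j) = (\<Sum>j\<in>{max_state M}. p j * v j)"
    by (intro sum.mono_neutral_right) auto
  then show ?thesis
    using interval assms by (simp add: interval_model_def)
qed

lemma reward_mono:
  assumes "s \<in> states M" "s' \<in> states M" "s \<le> s'" "k \<le> k'"
  shows "reward M s' k' \<le> reward M s k"
proof -
  have "gain M s' k' \<le> gain M s' k" "gain M s' k \<le> gain M s k"
    "carbon_cost M s k \<le> carbon_cost M s' k" "carbon_cost M s' k \<le> carbon_cost M s' k'"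
    using R assms by (auto simp: assumption_R_def)
  then show ?thesis by (simp add: reward_def)
qed

text \<open>Comparing infima of reals requires boundedness below; it holds for every
  \<open>V\<close>, as the weights \<open>p j\<close> lie between \<open>0\<close> and
  \<open>1\<close>.\<close>

lemma bdd_below_operating:
  assumes "s \<in> states M"
  shows "bdd_below ((\<lambda>p. reward M s k + discount M * (\<Sum>j\<in>states M. p j * V j)) `
           ambiguity_set M s k)"
proof (rule bdd_belowI2)
  fix p assume p: "p \<in> ambiguity_set M s k"
  have "- \<bar>V j\<bar> \<le> p j * V j" if j: "j \<in> states M" for j
  proof -
    have "p j \<le> (\<Sum>i\<in>states M. p i)"
      using ambiguity_set_nonneg[OF assms p] j by (intro member_le_sum) auto
    then have "\<bar>p j\<bar> \<le> 1"
      using ambiguity_set_nonneg[OF assms p j] ambiguity_set_sum[OF p] by simp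
    then have "\<bar>p j\<bar> * \<bar>V j\<bar> \<le> 1 * \<bar>V j\<bar>"
      by (intro mult_right_mono) auto
    then show ?thesis by (simp add: abs_mult[symmetric] abs_le_iff)
  qed
  then have "(\<Sum>j\<in>states M. - \<bar>V j\<bar>) \<le> (\<Sum>j\<in>states M. p j * V j)"
    by (rule sum_mono)
  then show "reward M s k + discount M * (\<Sum>j\<in>states M. - \<bar>V j\<bar>)
               \<le> reward M s k + discount M * (\<Sum>j\<in>states M. p j * V j)"
    using discount_pos by simp
qed

text \<open>All rows give the same expectation there, so the infimum is over a constant and the
  value is affine in \<open>V\<close>.\<close>

lemma action_value_0_max_state:
  "action_value M V (max_state M) k 0 =
     reward M (max_state M) k + discount M * V (max_state M) k"
proof -
  let ?c = "reward M (max_state M) k + discount M * V (max_state M) k"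
  have "action_value M V (max_state M) k 0 =
      (INF p\<in>ambiguity_set M (max_state M) k. ?c)"
    unfolding action_value_def
    by (auto intro!: INF_cong simp: ambiguity_set_max_state[of _ k "\<lambda>j. V j k"])
  then show ?thesis
    using ambiguity_set_nonempty[of "max_state M" k] by simp
qed

lemma action_value_0_zero:
  assumes "s \<in> states M"
  shows "action_value M (\<lambda>s k. 0) s k 0 = reward M s k"
  using ambiguity_set_nonempty[OF assms, of k] by (simp add: action_value_def)

section \<open>Monotonicity of the value iterates\<close>

text \<open>Each row \<open>p\<close> at the better point is answered by a dominated row
  \<open>q\<close> at the worse one, which earns no more.\<close>

lemma action_value_0_mono:
  assumes V: "\<And>s s' k k'. s \<in> states M \<Longrightarrow> s' \<in> states M \<Longrightarrow> s \<le> s' \<Longrightarrow> k \<le> k' \<Longrightarrow>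
      V s' k' \<le> V s k"
    and s: "s \<in> states M" "s' \<in> states M" "s \<le> s'" "k \<le> k'"
  shows "action_value M V s' k' 0 \<le> action_value M V s k 0"
proof -
  have "(INF p\<in>ambiguity_set M s' k'. reward M s' k' + discount M * (\<Sum>j\<in>states M. p j * V j k'))
      \<le> (INF p\<in>ambiguity_set M s k. reward M s k + discount M * (\<Sum>j\<in>states M. p j * V j k))"
  proof (rule cINF_mono[OF ambiguity_set_nonempty[OF s(1)] bdd_below_operating[OF s(2)]])
    fix p assume p: "p \<in> ambiguity_set M s k"
    obtain p' where p': "p' \<in> ambiguity_set M s' k'"
      using ambiguity_set_nonempty[OF s(2)] by blast
    \<comment> \<open>The change from \<open>(s, k)\<close> to \<open>(s', k')\<close> is made
      through \<open>(s', k)\<close>.\<close>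
    have l: "(\<Sum>j=0..i. eff_lower M s' k' j) \<le> (\<Sum>j=0..i. eff_lower M s k j)"
      and u: "(\<Sum>j=i..max_state M. eff_upper M s k j) \<le> (\<Sum>j=i..max_state M. eff_upper M s' k' j)"
      if "i \<le> max_state M" for i
      using mono_state[of i s s' k] mono_count[of i s' k k'] s that by auto
    obtain q where q: "\<And>j. j \<le> max_state M \<Longrightarrow> eff_lower M s' k' j \<le> q j \<and> q j \<le> eff_upper M s' k' j"
        "(\<Sum>j\<le>max_state M. q j) = 1"
        "\<And>i. i \<le> max_state M \<Longrightarrow> (\<Sum>j\<le>i. q j) \<le> (\<Sum>j\<le>i. p j)"
      using p p' interval_row_dominated[of "max_state M" "eff_lower M s k" p "eff_upper M s k"
          "eff_lower M s' k'" p' "eff_upper M s' k'", OF _ _ _ _ l u]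
      unfolding ambiguity_set_def by blast
    \<comment> \<open>Two stages: under \<open>q\<close>, the values at \<open>k'\<close> are at
      most those at \<open>k\<close>; for the values at \<open>k\<close>, dominance passes from
      \<open>q\<close> to \<open>p\<close>.\<close>
    have "(\<Sum>j\<in>states M. q j * V j k') \<le> (\<Sum>j\<in>states M. q j * V j k)"
      using V s ambiguity_set_nonneg[of s' q k'] q
      by (intro sum_mono mult_left_mono) (auto simp: ambiguity_set_def)
    also have "\<dots> \<le> (\<Sum>j\<in>states M. p j * V j k)"
      using q p V by (intro stochastic_dominance_sum_le) (auto simp: ambiguity_set_sum)
    finally have "reward M s' k' + discount M * (\<Sum>j\<in>states M. q j * V j k')
        \<le> reward M s k + discount M * (\<Sum>j\<in>states M. p j * V j k)"
      using reward_mono[OF s] discount_pos by (intro add_mono mult_left_mono) auto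
    moreover have "q \<in> ambiguity_set M s' k'"
      using q by (simp add: ambiguity_set_def)
    ultimately show "\<exists>q\<in>ambiguity_set M s' k'.
        reward M s' k' + discount M * (\<Sum>j\<in>states M. q j * V j k')
        \<le> reward M s k + discount M * (\<Sum>j\<in>states M. p j * V j k)"
      by blast
  qed
  then show ?thesis by (simp add: action_value_def)
qed

lemma value_iterate_mono:
  "s \<in> states M \<Longrightarrow> s' \<in> states M \<Longrightarrow> s \<le> s' \<Longrightarrow> k \<le> k' \<Longrightarrow>
     value_iterate M n s' k' \<le> value_iterate M n s k"
proof (induction n arbitrary: s s' k k')
  case 0
  then show ?case by simp
next
  case (Suc n)
  let ?w = "action_value M (value_iterate M n)"
  have "?w s' k' 0 \<le> ?w s k 0"
    using Suc by (intro action_value_0_mono) auto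
  moreover have "?w s' k' 1 \<le> ?w s k 1"
    using Suc discount_pos by (simp add: action_value_def)
  moreover have "?w s' k' 2 = ?w s k 2"
    by (simp add: action_value_def)
  ultimately show ?case
    by (auto simp: Max_action_value max_def)
qed

section \<open>Contraction and convergence\<close>

text \<open>Rows have mass \<open>1\<close>, so raising the values by \<open>D\<close> raises each
  expectation by \<open>D\<close>. The one-sided form serves both directions of the
  contraction.\<close>

lemma action_value_0_le_add:
  assumes s: "s \<in> states M"
    and D: "\<And>j. j \<in> states M \<Longrightarrow> V j k \<le> W j k + D"
  shows "action_value M V s k 0 \<le> action_value M W s k 0 + discount M * D"
proof -
  have "(INF p\<in>ambiguity_set M s k. reward M s k + discount M * (\<Sum>j\<in>states M. p j * V j k))
        - discount M * D
      \<le> (INF p\<in>ambiguity_set M s k. reward M s k + discount M * (\<Sum>j\<in>states M. p j * W j k))"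
  proof (rule cINF_greatest[OF ambiguity_set_nonempty[OF s]])
    fix p assume p: "p \<in> ambiguity_set M s k"
    have "(INF p\<in>ambiguity_set M s k. reward M s k + discount M * (\<Sum>j\<in>states M. p j * V j k))
        \<le> reward M s k + discount M * (\<Sum>j\<in>states M. p j * V j k)"
      by (rule cINF_lower[OF bdd_below_operating[OF s] p])
    also have "(\<Sum>j\<in>states M. p j * V j k) \<le> (\<Sum>j\<in>states M. p j * (W j k + D))"
      using D ambiguity_set_nonneg[OF s p] by (intro sum_mono mult_left_mono) auto
    then have "reward M s k + discount M * (\<Sum>j\<in>states M. p j * V j k)
        \<le> reward M s k + discount M * (\<Sum>j\<in>states M. p j * (W j k + D))"
      using discount_pos by simp
    also have "(\<Sum>j\<in>states M. p j * (W j k + D)) = (\<Sum>j\<in>states M. p j * W j k) + D"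
      using ambiguity_set_sum[OF p] by (simp add: distrib_left sum.distrib flip: sum_distrib_right)
    finally show "(INF p\<in>ambiguity_set M s k. reward M s k + discount M * (\<Sum>j\<in>states M. p j * V j k))
        - discount M * D \<le> reward M s k + discount M * (\<Sum>j\<in>states M. p j * W j k)"
      by (simp add: algebra_simps)
  qed
  then show ?thesis by (simp add: action_value_def)
qed

text \<open>Remanufacturing looks at count \<open>k + 1\<close>, so the bound is assumed at all
  counts; \<open>0 \<le> D\<close> covers scrapping, whose value stays fixed.\<close>

lemma Max_action_value_le_add:
  assumes s: "s \<in> states M" and D: "0 \<le> D"
    and VW: "\<And>j k. j \<in> states M \<Longrightarrow> V j k \<le> W j k + D"
  shows "Max (action_value M V s k ` actions) \<le> Max (action_value M W s k ` actions) + discount M * D"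
proof -
  have "action_value M V s k 0 \<le> action_value M W s k 0 + discount M * D"
    using s VW by (intro action_value_0_le_add) auto
  moreover have "action_value M V s k 1 \<le> action_value M W s k 1 + discount M * D"
    using mult_left_mono[OF VW[of 0 "Suc k"], of "discount M"] discount_pos
    by (simp add: action_value_def distrib_left)
  moreover have "action_value M V s k 2 \<le> action_value M W s k 2 + discount M * D"
    using D discount_pos by (simp add: action_value_def)
  ultimately show ?thesis by (auto simp: Max_action_value max_def)
qed

text \<open>Rewards may be unbounded below in \<open>k\<close>, but scrapping bounds the first iterate from below.\<close>

lemma value_iterate_diff_bound:
  "s \<in> states M \<Longrightarrow> \<bar>value_iterate M (Suc n) s k - value_iterate M n s k\<bar> \<le>
     (\<bar>reward M 0 0\<bar> + \<bar>reman_cost M\<bar> + \<bar>salvage_value M\<bar>) * discount M ^ n"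
proof (induction n arbitrary: s k)
  case 0
  have "reward M s k \<le> reward M 0 0"
    using 0 by (intro reward_mono) auto
  \<comment> \<open>Iteration starts at zero, so this is the first difference: it lies between the
    salvage value and the maximum of \<open>reward M 0 0\<close>, \<open>- reman_cost M\<close> and
    \<open>salvage_value M\<close>, whence the constant.\<close>
  moreover have "value_iterate M (Suc 0) s k =
      max (reward M s k) (max (- reman_cost M) (salvage_value M))"
    using action_value_0_zero[of s k] 0
    by (simp add: Max_action_value) (simp add: action_value_def)
  ultimately show ?case by simp
next
  case (Suc n)
  let ?D = "(\<bar>reward M 0 0\<bar> + \<bar>reman_cost M\<bar> + \<bar>salvage_value M\<bar>) * discount M ^ n"
  have D: "0 \<le> ?D" using discount_pos by simp
  have IH: "value_iterate M (Suc n) j k \<le> value_iterate M n j k + ?D"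
    "value_iterate M n j k \<le> value_iterate M (Suc n) j k + ?D" if "j \<in> states M" for j k
    using Suc.IH[OF that, of k] by linarith+
  have "value_iterate M (Suc (Suc n)) s k \<le> value_iterate M (Suc n) s k + discount M * ?D"
    using Max_action_value_le_add[of s ?D "value_iterate M (Suc n)" "value_iterate M n" k, OF Suc.prems D IH(1)]
    by (simp only: value_iterate.simps(2))
  moreover have "value_iterate M (Suc n) s k \<le> value_iterate M (Suc (Suc n)) s k + discount M * ?D"
    using Max_action_value_le_add[of s ?D "value_iterate M n" "value_iterate M (Suc n)" k, OF Suc.prems D IH(2)]
    by (simp only: value_iterate.simps(2))
  ultimately show ?case
    by (simp only: abs_le_iff power_Suc mult.left_commute[of _ "discount M"]) linarith
qed

text \<open>\<open>lim\<close> is informative only under convergence. The iterates, starting at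
  zero, are partial sums of increments dominated by a geometric series.\<close>

lemma value_iterate_LIMSEQ:
  assumes "s \<in> states M"
  shows "(\<lambda>n. value_iterate M n s k) \<longlonglongrightarrow> robust_value M s k"
proof -
  let ?C = "\<bar>reward M 0 0\<bar> + \<bar>reman_cost M\<bar> + \<bar>salvage_value M\<bar>"
  have "summable (\<lambda>n. ?C * discount M ^ n)"
    using discount_pos discount_less_1 by (intro summable_mult summable_geometric) simp
  then have "summable (\<lambda>n. value_iterate M (Suc n) s k - value_iterate M n s k)"
    by (rule summable_comparison_test'[where N = 0])
      (use value_iterate_diff_bound[OF assms] in \<open>simp only: real_norm_def\<close>)
  then have "convergent (\<lambda>n. \<Sum>i<n. value_iterate M (Suc i) s k - value_iterate M i s k)"
    by (simp only: summable_iff_convergent)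
  then have "convergent (\<lambda>n. value_iterate M n s k)"
    by (simp only: sum_lessThan_telescope[of "\<lambda>n. value_iterate M n s k"] value_iterate.simps(1) diff_0_right)
  then show ?thesis
    by (simp add: robust_value_def convergent_LIMSEQ_iff)
qed

section \<open>The limit value function\<close>

lemma robust_value_mono:
  assumes "s \<in> states M" "s' \<in> states M" "s \<le> s'" "k \<le> k'"
  shows "robust_value M s' k' \<le> robust_value M s k"
  using value_iterate_LIMSEQ[OF assms(2)] value_iterate_LIMSEQ[OF assms(1)]
  by (rule LIMSEQ_le) (use value_iterate_mono[OF assms] in blast)

text \<open>At the absorbing condition operating is affine in the values, so the limit passes
  through without being exchanged with an infimum.\<close>

lemma robust_value_max_state:
  "robust_value M (max_state M) k =
     Max (action_value M (robust_value M) (max_state M) k ` actions)"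
proof -
  let ?S = "max_state M" and ?V = "value_iterate M"
  have "(\<lambda>n. max (reward M ?S k + discount M * ?V n ?S k)
          (max (- reman_cost M + discount M * ?V n 0 (k + 1)) (salvage_value M)))
      \<longlonglongrightarrow> max (reward M ?S k + discount M * robust_value M ?S k)
          (max (- reman_cost M + discount M * robust_value M 0 (k + 1)) (salvage_value M))"
    by (intro tendsto_intros value_iterate_LIMSEQ) auto
  then have "(\<lambda>n. ?V (Suc n) ?S k) \<longlonglongrightarrow> Max (action_value M (robust_value M) ?S k ` actions)"
    by (simp add: Max_action_value action_value_0_max_state) (simp add: action_value_def)
  moreover have "(\<lambda>n. ?V (Suc n) ?S k) \<longlonglongrightarrow> robust_value M ?S k"
    by (rule LIMSEQ_Suc[OF value_iterate_LIMSEQ]) simp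
  ultimately show ?thesis by (rule LIMSEQ_unique[symmetric])
qed

lemma operating_not_optimal_max_state:
  "\<not> optimal_action M (max_state M) k 0"
proof
  let ?S = "max_state M" and ?w = "action_value M (robust_value M)"
  assume "optimal_action M ?S k 0"
  then have le: "?w ?S k 1 \<le> ?w ?S k 0" "?w ?S k 2 \<le> ?w ?S k 0"
    by (auto simp: optimal_action_def is_arg_max_linorder actions_def)
  then have V: "robust_value M ?S k = ?w ?S k 0"
    by (simp add: robust_value_max_state Max_action_value)
  \<comment> \<open>The Bellman equation is now linear; its solution is the worth of operating at
    the last condition forever.\<close>
  then have "(1 - discount M) * robust_value M ?S k = reward M ?S k"
    by (simp add: action_value_0_max_state algebra_simps)
  also have "\<dots> \<le> reward M ?S 0"
    by (rule reward_mono) auto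
  also have "\<dots> < (1 - discount M) * salvage_value M"
    using R discount_less_1 by (simp add: assumption_R_def pos_divide_less_eq mult.commute)
  finally have "robust_value M ?S k < salvage_value M"
    using discount_less_1 by simp
  then show False
    using le V by (simp add: action_value_def)
qed

end

section \<open>Tie-breaking and thresholds\<close>

text \<open>The policy picks the lexicographic winner: larger value, then smaller
  \<open>pref\<close>. Pairwise comparisons in this form carry over between points
  \<open>(s, k)\<close> even when values tie.\<close>

lemma optimal_policy_iff:
  assumes pol: "optimal_policy M pref a" and s: "s \<in> states M"
  shows "a s k = x \<longleftrightarrow> x \<in> actions \<and> (\<forall>y\<in>actions - {x}.
      action_value M (robust_value M) s k y < action_value M (robust_value M) s k x \<or>
      action_value M (robust_value M) s k y = action_value M (robust_value M) s k x \<and>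
      pref x < pref y)" (is "_ \<longleftrightarrow> ?best x")
proof
  let ?w = "action_value M (robust_value M) s k"
  have a: "is_arg_min pref (optimal_action M s k) (a s k)" and inj: "inj_on pref actions"
    using pol s by (auto simp: optimal_policy_def)
  have opt: "optimal_action M s k y \<longleftrightarrow> y \<in> actions \<and> (\<forall>z\<in>actions. ?w z \<le> ?w y)" for y
    by (auto simp: optimal_action_def is_arg_max_linorder)
  have best: "?best (a s k)"
  proof (intro conjI ballI)
    show "a s k \<in> actions"
      using a by (auto simp: is_arg_min_def opt)
    fix y assume y: "y \<in> actions - {a s k}"
    then have "?w y \<le> ?w (a s k)"
      using a by (auto simp: is_arg_min_def opt)
    moreover have "pref (a s k) < pref y" if "?w y = ?w (a s k)"
    proof -
      have "optimal_action M s k y"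
        using a y that by (auto simp: is_arg_min_def opt)
      then have "pref (a s k) \<le> pref y"
        using a by (auto simp: is_arg_min_linorder)
      moreover have "pref (a s k) \<noteq> pref y"
        using inj y \<open>a s k \<in> actions\<close> by (auto dest: inj_onD)
      ultimately show ?thesis by simp
    qed
    ultimately show "?w y < ?w (a s k) \<or> ?w y = ?w (a s k) \<and> pref (a s k) < pref y"
      by auto
  qed
  show "?best x" if "a s k = x"
    using best that by simp
  show "a s k = x" if x: "?best x"
  proof (rule ccontr)
    assume "a s k \<noteq> x"
    then have "x \<in> actions - {a s k}" "a s k \<in> actions - {x}"
      using best x by auto
    \<comment> \<open>Two distinct winners would strictly beat each other.\<close>
    then show False
      using bspec[OF conjunct2[OF best], of x] bspec[OF conjunct2[OF x], of "a s k"] by auto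
  qed
qed

theorem theorem3:
  fixes M :: remanufacturing_model
    and pref :: "nat \<Rightarrow> nat"
    and a :: "nat \<Rightarrow> nat \<Rightarrow> nat"
  assumes "interval_model M"
    and "assumption_R M"
    and "\<And>i k s s'. i \<in> states M \<Longrightarrow> s \<in> states M \<Longrightarrow> s' \<in> states M \<Longrightarrow> s \<le> s' \<Longrightarrow>
           (\<Sum>s''=0..i. eff_lower M s k s'') \<ge> (\<Sum>s''=0..i. eff_lower M s' k s'') \<and>
           (\<Sum>s''=i..max_state M. eff_upper M s k s'') \<le> (\<Sum>s''=i..max_state M. eff_upper M s' k s'')"
    and "\<And>i s k k'. i \<in> states M \<Longrightarrow> s \<in> states M \<Longrightarrow> k \<le> k' \<Longrightarrow>
           (\<Sum>s''=0..i. eff_lower M s k s'') \<ge> (\<Sum>s''=0..i. eff_lower M s k' s'') \<and>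
           (\<Sum>s''=i..max_state M. eff_upper M s k s'') \<le> (\<Sum>s''=i..max_state M. eff_upper M s k' s'')"
    and "optimal_policy M pref a"
  shows "\<exists>(kstar :: enat) (threshold :: nat \<Rightarrow> nat).
           (\<forall>k. threshold k \<in> states M) \<and>
           (\<forall>k. \<forall>s\<in>states M.
              (enat k < kstar \<longrightarrow> a s k = (if s < threshold k then 0 else 1)) \<and>
              (kstar \<le> enat k \<longrightarrow> a s k = (if s < threshold k then 0 else 2)))"
proof -
  interpret monotone_interval_model M
    using assms(1-4) by unfold_locales
  let ?w = "action_value M (robust_value M)"
  note policy_iff = optimal_policy_iff[OF assms(5)]
  have mem: "a s k = 0 \<or> a s k = 1 \<or> a s k = 2" if "s \<in> states M" for s k
    using policy_iff[OF that, of k "a s k"] by (auto simp: actions_def)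
  \<comment> \<open>A better condition can only raise the value of operating and leaves the other
    two fixed, so a win of operating persists, ties included.\<close>
  have operate_downward: "a s k = 0" if "a s' k = 0" "s' \<in> states M" "s \<le> s'" for s s' k
  proof -
    have s: "s \<in> states M" using that by simp
    have "?w s' k 0 \<le> ?w s k 0"
      using robust_value_mono s that by (intro action_value_0_mono) auto
    moreover have "?w s' k 1 = ?w s k 1" "?w s' k 2 = ?w s k 2"
      by (auto simp: action_value_def)
    ultimately show ?thesis
      using that policy_iff[OF s, of k 0] policy_iff[OF that(2), of k 0]
      by (auto simp: actions_def)
  qed
  have not_operate: "a (max_state M) k \<noteq> 0" for k
  proof
    assume "a (max_state M) k = 0"
    moreover have "optimal_action M (max_state M) k (a (max_state M) k)"
      using assms(5) by (auto simp: optimal_policy_def is_arg_min_def)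
    ultimately show False
      using operating_not_optimal_max_state by simp
  qed
  \<comment> \<open>Operating is never chosen at \<open>max_state M\<close>, so the least condition
    exists and is a state.\<close>
  define threshold where "threshold k = (LEAST s. a s k \<noteq> 0)" for k
  have threshold: "threshold k \<in> states M" "a (threshold k) k \<noteq> 0" for k
    using not_operate[of k] Least_le[of "\<lambda>s. a s k \<noteq> 0", OF not_operate]
      LeastI[of "\<lambda>s. a s k \<noteq> 0", OF not_operate] by (auto simp: threshold_def)
  have operate_iff: "a s k = 0 \<longleftrightarrow> s < threshold k" if "s \<in> states M" for s k
    using operate_downward[OF _ that, of k "threshold k"] threshold[of k]
      not_less_Least[of s "\<lambda>s. a s k \<noteq> 0"] by (auto simp: threshold_def not_less[symmetric])
  \<comment> \<open>Neither value depends on the condition, so \<open>0\<close> stands for all; ties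
    are settled by \<open>pref\<close>.\<close>
  define scrap where "scrap k \<longleftrightarrow> ?w 0 k 1 < ?w 0 k 2 \<or> ?w 0 k 1 = ?w 0 k 2 \<and> pref 2 < pref 1" for k
  have scrap_mono: "scrap k'" if "scrap k" "k \<le> k'" for k k'
  proof -
    have "?w 0 k' 1 \<le> ?w 0 k 1"
      using robust_value_mono[of 0 0 "k + 1" "k' + 1"] discount_pos that(2)
      by (simp add: action_value_def)
    moreover have "?w 0 k' 2 = ?w 0 k 2"
      by (simp add: action_value_def)
    ultimately show ?thesis using that(1) by (auto simp: scrap_def)
  qed
  have action: "a s k = (if s < threshold k then 0 else if scrap k then 2 else 1)"
    if s: "s \<in> states M" for s k
  proof -
    have scrap_iff: "scrap k \<longleftrightarrow> ?w s k 1 < ?w s k 2 \<or> ?w s k 1 = ?w s k 2 \<and> pref 2 < pref 1"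
      by (simp add: scrap_def action_value_def)
    have best: "?w s k y < ?w s k x \<or> ?w s k y = ?w s k x \<and> pref x < pref y"
      if "a s k = x" "y \<in> actions" "y \<noteq> x" for x y
      using that policy_iff[OF s, of k x] by blast
    have "\<not> scrap k" if "a s k = 1"
      using best[OF that, of 2] unfolding scrap_iff by (simp add: actions_def) linarith
    moreover have "scrap k" if "a s k = 2"
      using best[OF that, of 1] unfolding scrap_iff by (simp add: actions_def)
    ultimately show ?thesis
      using mem[OF s, of k] operate_iff[OF s, of k] by auto
  qed
  \<comment> \<open>\<open>\<infinity>\<close> covers the case that scrapping never beats
    remanufacturing, so that the second regime is empty.\<close>
  define kstar where "kstar = (if \<exists>k. scrap k then enat (LEAST k. scrap k) else \<infinity>)"
  have kstar: "kstar \<le> enat k \<longleftrightarrow> scrap k" for k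
  proof (cases "\<exists>k. scrap k")
    case True
    then have "scrap (LEAST k. scrap k)"
      by (rule LeastI_ex)
    then show ?thesis
      using True scrap_mono[of "LEAST k. scrap k" k] Least_le[of scrap k] by (auto simp: kstar_def)
  qed (simp add: kstar_def)
  show ?thesis
    using threshold(1) action kstar
    by (intro exI[of _ kstar] exI[of _ threshold]) (auto simp flip: not_le)
qed

end
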